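(* Let $H$ be a monoid and $N$ an abelian group. Let $\Gamma_1\colon N \xrightarrow{k_1} G_1 \xrightarrow{e_1} H$ be a cosetal extension corresponding to $[g_1]_{E_1} \in \mathcal{H}^2(H,N,E_1,[\phi_1])$ and let $\Gamma_2\colon N \xrightarrow{k_2} G_2 \xrightarrow{e_2} H$ be a cosetal extension corresponding to $[g_2]_{E_2} \in \mathcal{H}^2(H,N,E_2,[\phi_2])$. Then there exists a morphism of extensions $f\colon G_1 \to G_2$ (a monoid homomorphism with $fk_1 = k_2$ and $e_2 f = e_1$) if and only if $(E_1,[\phi_1]) \le (E_2,[\phi_2])$ and $[g_1]_{E_2} = [g_2]_{E_2}$ (equality in $\mathcal{H}^2(H,N,E_2,[\phi_2])$).
   Context: $H$ is a monoid and $N$ is an abelian group (written multiplicatively). Extensions. A diagram $N \xrightarrow{k} G \xrightarrow{e} H$ of monoids is an extension if $k$ is the kernel of $e$ ($k$ is injective with image $e^{-1}(1)$) and $e$ is the cokernel of $k$ ($e$ is, up to isomorphism, the quotient of $G$ by the congruence generated by $k(n)\sim 1$, $n\in N$). It is cosetal if whenever $e(g)=e(g')$ there is $n\in N$ with $g=k(n)g'$. A morphism of extensions of $H$ by $N$ is a monoid homomorphism $f\colon G_1\to G_2$ with $fk_1=k_2$ and $e_2f=e_1$. Compatible pairs. An $H$-indexed equivalence relation $E$ on $N$ is a family $(\sim^h)_{h\in H}$ (also written $\sim^h_E$) of equivalence relations on $N$; $E\subseteq E'$ means pointwise inclusion. $E$ is admissible if for all $n,n',x\in N$, $h,y\in H$: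 (1) $n\sim^1 n'$ implies $n=n'$; (2) $n\sim^h n'$ implies $xn\sim^h xn'$; (3) $n\sim^h n'$ implies $n\sim^{hy}n'$. A map $\phi\colon H\times N\to N$ is a compatible action with respect to an admissible $E$ if (1) $n\sim^h n'$ implies $n\phi(h,x)\sim^h n'\phi(h,x)$ for all $x\in N$; (2) $n\sim^h n'$ implies $\phi(x,n)\sim^{xh}\phi(x,n')$ for all $x\in H$; (3) $\phi(h,nn')\sim^h\phi(h,n)\phi(h,n')$; (4) $\phi(hh',n)\sim^{hh'}\phi(h,\phi(h',n))$; (5) $\phi(h,1)\sim^h 1$; (6) $\phi(1,n)\sim^1 n$. Then $(E,\phi)$ is a compatible pair. Write $[\phi]=[\phi]_E$ for the class of $\phi$ under: $\phi\sim\phi'$ iff $\phi(h,n)\sim_E^h\phi'(h,n)$ for all $h,n$. Order: $(E,[\phi]_E)\le(E',[\phi']_{E'})$ iff $E\subseteq E'$ and $[\phi]_{E'}=[\phi']_{E'}$, i.e. $\phi(h,n)\sim_{E'}^h\phi'(h,n)$ for all $h,n$. Pair associated to a cosetal extension. Let $s$ be a set-theoretic section of $e$. Put $n\sim^h n'$ iff $k(n)s(h)=k(n')s(h)$, and let $\phi(h,n)$ be any element with $k\phi(h,n)s(h)=s(h)k(n)$. This gives a compatible pair; $E$ and $[\phi]_E$ do not depend on the choices. $\mathrm{CExt}(H,N,E,[\phi])$ is the set of isomorphism classes of cosetal extensions with associated pair $(E,[\phi])$. Cohomology. A factor set for $(E,[\phi])$ is a map $g\colon H\times H\to N$ with $g(h,1)\sim^h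 1\sim^h g(1,h)$ and $g(x,y)g(xy,z)\sim^{xyz}\phi(x,g(y,z))g(x,yz)$. Inner factor sets are those of the form $\delta t(h,h')=\phi(h,t(h'))\,t(hh')^{-1}t(h)$ for $t\colon H\to N$ with $t(1)=1$. Put $g\equiv g'$ iff there is an inner factor set $\delta t$ with $\delta t(h,h')\,g'(h,h')\sim^{hh'}g(h,h')$ for all $h,h'$. $\mathcal{H}^2(H,N,E,[\phi])$ is the abelian group of $\equiv$-classes $[g]=[g]_E$ of factor sets under pointwise multiplication. If $(E_1,[\phi])\le(E_2,[\phi])$, a factor set for $(E_1,[\phi])$ is also one for $(E_2,[\phi])$, and $[g]_{E_2}$ denotes its class in $\mathcal{H}^2(H,N,E_2,[\phi])$. Crossed product. $N\rtimes_{E,\phi}^g H$ is the monoid with underlying set $\bigsqcup_{h\in H}N/{\sim^h}$, elements written $([n],h)$, unit $([1],1)$ and product $([n],h)([n'],h')=([n\phi(h,n')g(h,h')],hh')$; with $k(n)=([n],1)$ and $e([n],h)=h$ it is a cosetal extension of $H$ by $N$ with associated pair $(E,[\phi])$. A cosetal extension corresponds to $[g]\in\mathcal{H}^2(H,N,E,[\phi])$ if it is isomorphic, as an extension, to $N\rtimes_{E,\phi}^g H$; this gives a bijection between $\mathrm{CExt}(H,N,E,[\phi])$ and $\mathcal{H}^2(H,N,E,[\phi])$. *)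

theory Defs
  imports "HOL-Algebra.Algebra"
begin

section \<open>Extensions of a monoid by a group\<close>

text \<open>The library set \<^term>\<open>hom G H\<close> does not require preservation of the unit, which is not
  automatic for monoids.\<close>

definition monoid_hom ::
  "('a, 'p) monoid_scheme \<Rightarrow> ('b, 'q) monoid_scheme \<Rightarrow> ('a \<Rightarrow> 'b) set" where
  "monoid_hom G H = {f \<in> hom G H. f \<one>\<^bsub>G\<^esub> = \<one>\<^bsub>H\<^esub>}"

definition monoid_congruence :: "('a, 'p) monoid_scheme \<Rightarrow> ('a \<times> 'a) set \<Rightarrow> bool" where
  "monoid_congruence G R \<longleftrightarrow>
     equiv (carrier G) R \<and>
     (\<forall>a b c d. (a, b) \<in> R \<longrightarrow> (c, d) \<in> R \<longrightarrow> (a \<otimes>\<^bsub>G\<^esub> c, b \<otimes>\<^bsub>G\<^esub> d) \<in> R)"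

definition generated_congruence ::
  "('a, 'p) monoid_scheme \<Rightarrow> ('a \<times> 'a) set \<Rightarrow> ('a \<times> 'a) set" where
  "generated_congruence G S = \<Inter>{R. monoid_congruence G R \<and> S \<subseteq> R}"

text \<open>In the next definition the union is a single class when \<^term>\<open>R\<close> is a congruence and
  \<^term>\<open>A\<close>, \<^term>\<open>B\<close> are classes; the same device is used for every product of classes below.\<close>

definition quotient_monoid ::
  "('a, 'p) monoid_scheme \<Rightarrow> ('a \<times> 'a) set \<Rightarrow> 'a set monoid" where
  "quotient_monoid G R =
     \<lparr>carrier = carrier G // R,
      monoid.mult = (\<lambda>A B. \<Union>a\<in>A. \<Union>b\<in>B. R `` {a \<otimes>\<^bsub>G\<^esub> b}),
      one = R `` {\<one>\<^bsub>G\<^esub>}\<rparr>"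

definition is_kernel ::
  "('n, 'r) monoid_scheme \<Rightarrow> ('n \<Rightarrow> 'a) \<Rightarrow> ('a, 'p) monoid_scheme \<Rightarrow> ('a \<Rightarrow> 'h) \<Rightarrow>
   ('h, 's) monoid_scheme \<Rightarrow> bool" where
  "is_kernel N k G e H \<longleftrightarrow> inj_on k (carrier N) \<and> k ` carrier N = kernel G H e"

definition is_cokernel ::
  "('n, 'r) monoid_scheme \<Rightarrow> ('n \<Rightarrow> 'a) \<Rightarrow> ('a, 'p) monoid_scheme \<Rightarrow> ('a \<Rightarrow> 'h) \<Rightarrow>
   ('h, 's) monoid_scheme \<Rightarrow> bool" where
  "is_cokernel N k G e H \<longleftrightarrow>
     (let R = generated_congruence G {(k n, \<one>\<^bsub>G\<^esub>) | n. n \<in> carrier N}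
      in \<exists>\<psi> \<in> iso (quotient_monoid G R) H. \<forall>x \<in> carrier G. \<psi> (R `` {x}) = e x)"

definition extension ::
  "('n, 'r) monoid_scheme \<Rightarrow> ('n \<Rightarrow> 'a) \<Rightarrow> ('a, 'p) monoid_scheme \<Rightarrow> ('a \<Rightarrow> 'h) \<Rightarrow>
   ('h, 's) monoid_scheme \<Rightarrow> bool" where
  "extension N k G e H \<longleftrightarrow>
     monoid G \<and> k \<in> monoid_hom N G \<and> e \<in> monoid_hom G H \<and>
     is_kernel N k G e H \<and> is_cokernel N k G e H"

definition cosetal_extension ::
  "('n, 'r) monoid_scheme \<Rightarrow> ('n \<Rightarrow> 'a) \<Rightarrow> ('a, 'p) monoid_scheme \<Rightarrow> ('a \<Rightarrow> 'h) \<Rightarrow>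
   ('h, 's) monoid_scheme \<Rightarrow> bool" where
  "cosetal_extension N k G e H \<longleftrightarrow>
     extension N k G e H \<and>
     (\<forall>x \<in> carrier G. \<forall>y \<in> carrier G. e x = e y \<longrightarrow> (\<exists>n \<in> carrier N. x = k n \<otimes>\<^bsub>G\<^esub> y))"

definition extension_morphism ::
  "('n, 'r) monoid_scheme \<Rightarrow>
   ('n \<Rightarrow> 'a) \<Rightarrow> ('a, 'p) monoid_scheme \<Rightarrow> ('a \<Rightarrow> 'h) \<Rightarrow>
   ('n \<Rightarrow> 'b) \<Rightarrow> ('b, 'q) monoid_scheme \<Rightarrow> ('b \<Rightarrow> 'h) \<Rightarrow> ('a \<Rightarrow> 'b) \<Rightarrow> bool" where
  "extension_morphism N k\<^sub>1 G\<^sub>1 e\<^sub>1 k\<^sub>2 G\<^sub>2 e\<^sub>2 f \<longleftrightarrow>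
     f \<in> monoid_hom G\<^sub>1 G\<^sub>2 \<and>
     (\<forall>n \<in> carrier N. f (k\<^sub>1 n) = k\<^sub>2 n) \<and>
     (\<forall>x \<in> carrier G\<^sub>1. e\<^sub>2 (f x) = e\<^sub>1 x)"

definition extension_isomorphic ::
  "('n, 'r) monoid_scheme \<Rightarrow>
   ('n \<Rightarrow> 'a) \<Rightarrow> ('a, 'p) monoid_scheme \<Rightarrow> ('a \<Rightarrow> 'h) \<Rightarrow>
   ('n \<Rightarrow> 'b) \<Rightarrow> ('b, 'q) monoid_scheme \<Rightarrow> ('b \<Rightarrow> 'h) \<Rightarrow> bool" where
  "extension_isomorphic N k\<^sub>1 G\<^sub>1 e\<^sub>1 k\<^sub>2 G\<^sub>2 e\<^sub>2 \<longleftrightarrow>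
     (\<exists>f \<in> iso G\<^sub>1 G\<^sub>2. extension_morphism N k\<^sub>1 G\<^sub>1 e\<^sub>1 k\<^sub>2 G\<^sub>2 e\<^sub>2 f)"


section \<open>Compatible pairs\<close>

text \<open>An \<^term>\<open>H\<close>-indexed equivalence relation is a map \<^term>\<open>E\<close> whose value at
  \<^term>\<open>h \<in> carrier H\<close> is the relation \<open>\<sim>\<^sup>h\<close>.  Values of \<^term>\<open>E\<close>, of actions
  and of factor sets at arguments outside the carriers are never used.\<close>

definition indexed_equiv ::
  "('h, 's) monoid_scheme \<Rightarrow> ('n, 'r) monoid_scheme \<Rightarrow> ('h \<Rightarrow> ('n \<times> 'n) set) \<Rightarrow> bool" where
  "indexed_equiv H N E \<longleftrightarrow> (\<forall>h \<in> carrier H. equiv (carrier N) (E h))"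

definition admissible ::
  "('h, 's) monoid_scheme \<Rightarrow> ('n, 'r) monoid_scheme \<Rightarrow> ('h \<Rightarrow> ('n \<times> 'n) set) \<Rightarrow> bool" where
  "admissible H N E \<longleftrightarrow>
     indexed_equiv H N E \<and>
     (\<forall>n \<in> carrier N. \<forall>n' \<in> carrier N. (n, n') \<in> E \<one>\<^bsub>H\<^esub> \<longrightarrow> n = n') \<and>
     (\<forall>h \<in> carrier H. \<forall>n \<in> carrier N. \<forall>n' \<in> carrier N. \<forall>x \<in> carrier N.
        (n, n') \<in> E h \<longrightarrow> (x \<otimes>\<^bsub>N\<^esub> n, x \<otimes>\<^bsub>N\<^esub> n') \<in> E h) \<and>
     (\<forall>h \<in> carrier H. \<forall>y \<in> carrier H. \<forall>n \<in> carrier N. \<forall>n' \<in> carrier N.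
        (n, n') \<in> E h \<longrightarrow> (n, n') \<in> E (h \<otimes>\<^bsub>H\<^esub> y))"

definition compatible_action ::
  "('h, 's) monoid_scheme \<Rightarrow> ('n, 'r) monoid_scheme \<Rightarrow> ('h \<Rightarrow> ('n \<times> 'n) set) \<Rightarrow>
   ('h \<Rightarrow> 'n \<Rightarrow> 'n) \<Rightarrow> bool" where
  "compatible_action H N E \<phi> \<longleftrightarrow>
     \<phi> \<in> carrier H \<rightarrow> carrier N \<rightarrow> carrier N \<and>
     (\<forall>h \<in> carrier H. \<forall>n \<in> carrier N. \<forall>n' \<in> carrier N. \<forall>x \<in> carrier N.
        (n, n') \<in> E h \<longrightarrow> (n \<otimes>\<^bsub>N\<^esub> \<phi> h x, n' \<otimes>\<^bsub>N\<^esub> \<phi> h x) \<in> E h) \<and>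
     (\<forall>h \<in> carrier H. \<forall>x \<in> carrier H. \<forall>n \<in> carrier N. \<forall>n' \<in> carrier N.
        (n, n') \<in> E h \<longrightarrow> (\<phi> x n, \<phi> x n') \<in> E (x \<otimes>\<^bsub>H\<^esub> h)) \<and>
     (\<forall>h \<in> carrier H. \<forall>n \<in> carrier N. \<forall>n' \<in> carrier N.
        (\<phi> h (n \<otimes>\<^bsub>N\<^esub> n'), \<phi> h n \<otimes>\<^bsub>N\<^esub> \<phi> h n') \<in> E h) \<and>
     (\<forall>h \<in> carrier H. \<forall>h' \<in> carrier H. \<forall>n \<in> carrier N.
        (\<phi> (h \<otimes>\<^bsub>H\<^esub> h') n, \<phi> h (\<phi> h' n)) \<in> E (h \<otimes>\<^bsub>H\<^esub> h')) \<and>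
     (\<forall>h \<in> carrier H. (\<phi> h \<one>\<^bsub>N\<^esub>, \<one>\<^bsub>N\<^esub>) \<in> E h) \<and>
     (\<forall>n \<in> carrier N. (\<phi> \<one>\<^bsub>H\<^esub> n, n) \<in> E \<one>\<^bsub>H\<^esub>)"

definition compatible_pair ::
  "('h, 's) monoid_scheme \<Rightarrow> ('n, 'r) monoid_scheme \<Rightarrow> ('h \<Rightarrow> ('n \<times> 'n) set) \<Rightarrow>
   ('h \<Rightarrow> 'n \<Rightarrow> 'n) \<Rightarrow> bool" where
  "compatible_pair H N E \<phi> \<longleftrightarrow> admissible H N E \<and> compatible_action H N E \<phi>"

text \<open>The class \<open>[\<phi>]\<^sub>E\<close> is taken among all maps \<open>H \<times> N \<rightarrow> N\<close>, since in the order below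
  \<^term>\<open>\<phi>\<close> is a priori not compatible with the larger relation.\<close>

definition action_rel ::
  "('h, 's) monoid_scheme \<Rightarrow> ('n, 'r) monoid_scheme \<Rightarrow> ('h \<Rightarrow> ('n \<times> 'n) set) \<Rightarrow>
   (('h \<Rightarrow> 'n \<Rightarrow> 'n) \<times> ('h \<Rightarrow> 'n \<Rightarrow> 'n)) set" where
  "action_rel H N E =
     {(\<phi>, \<phi>'). \<phi> \<in> carrier H \<rightarrow> carrier N \<rightarrow> carrier N \<and> \<phi>' \<in> carrier H \<rightarrow> carrier N \<rightarrow> carrier N \<and>
        (\<forall>h \<in> carrier H. \<forall>n \<in> carrier N. (\<phi> h n, \<phi>' h n) \<in> E h)}"

definition action_class ::
  "('h, 's) monoid_scheme \<Rightarrow> ('n, 'r) monoid_scheme \<Rightarrow> ('h \<Rightarrow> ('n \<times> 'n) set) \<Rightarrow>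
   ('h \<Rightarrow> 'n \<Rightarrow> 'n) \<Rightarrow> ('h \<Rightarrow> 'n \<Rightarrow> 'n) set" where
  "action_class H N E \<phi> = action_rel H N E `` {\<phi>}"

text \<open>\<open>pair_le H N E \<phi> E' \<phi>'\<close> is the order \<open>(E, [\<phi>]\<^sub>E) \<le> (E', [\<phi>']\<^sub>E')\<close>, expressed on
  representatives.\<close>

definition pair_le ::
  "('h, 's) monoid_scheme \<Rightarrow> ('n, 'r) monoid_scheme \<Rightarrow>
   ('h \<Rightarrow> ('n \<times> 'n) set) \<Rightarrow> ('h \<Rightarrow> 'n \<Rightarrow> 'n) \<Rightarrow>
   ('h \<Rightarrow> ('n \<times> 'n) set) \<Rightarrow> ('h \<Rightarrow> 'n \<Rightarrow> 'n) \<Rightarrow> bool" where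
  "pair_le H N E \<phi> E' \<phi>' \<longleftrightarrow>
     (\<forall>h \<in> carrier H. E h \<subseteq> E' h) \<and> action_class H N E' \<phi> = action_class H N E' \<phi>'"


section \<open>The second cohomology group\<close>

definition factor_sets ::
  "('h, 's) monoid_scheme \<Rightarrow> ('n, 'r) monoid_scheme \<Rightarrow> ('h \<Rightarrow> ('n \<times> 'n) set) \<Rightarrow>
   ('h \<Rightarrow> 'n \<Rightarrow> 'n) \<Rightarrow> ('h \<Rightarrow> 'h \<Rightarrow> 'n) set" where
  "factor_sets H N E \<phi> =
     {g \<in> carrier H \<rightarrow> carrier H \<rightarrow> carrier N.
        (\<forall>h \<in> carrier H. (g h \<one>\<^bsub>H\<^esub>, \<one>\<^bsub>N\<^esub>) \<in> E h \<and> (\<one>\<^bsub>N\<^esub>, g \<one>\<^bsub>H\<^esub> h) \<in> E h) \<and>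
        (\<forall>x \<in> carrier H. \<forall>y \<in> carrier H. \<forall>z \<in> carrier H.
           (g x y \<otimes>\<^bsub>N\<^esub> g (x \<otimes>\<^bsub>H\<^esub> y) z, \<phi> x (g y z) \<otimes>\<^bsub>N\<^esub> g x (y \<otimes>\<^bsub>H\<^esub> z))
             \<in> E (x \<otimes>\<^bsub>H\<^esub> y \<otimes>\<^bsub>H\<^esub> z))}"

definition coboundary ::
  "('h, 's) monoid_scheme \<Rightarrow> ('n, 'r) monoid_scheme \<Rightarrow> ('h \<Rightarrow> 'n \<Rightarrow> 'n) \<Rightarrow>
   ('h \<Rightarrow> 'n) \<Rightarrow> 'h \<Rightarrow> 'h \<Rightarrow> 'n" where
  "coboundary H N \<phi> t h h' = \<phi> h (t h') \<otimes>\<^bsub>N\<^esub> inv\<^bsub>N\<^esub> (t (h \<otimes>\<^bsub>H\<^esub> h')) \<otimes>\<^bsub>N\<^esub> t h"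

definition inner_factor_sets ::
  "('h, 's) monoid_scheme \<Rightarrow> ('n, 'r) monoid_scheme \<Rightarrow> ('h \<Rightarrow> 'n \<Rightarrow> 'n) \<Rightarrow>
   ('h \<Rightarrow> 'h \<Rightarrow> 'n) set" where
  "inner_factor_sets H N \<phi> =
     {coboundary H N \<phi> t | t. t \<in> carrier H \<rightarrow> carrier N \<and> t \<one>\<^bsub>H\<^esub> = \<one>\<^bsub>N\<^esub>}"

definition cohomologous ::
  "('h, 's) monoid_scheme \<Rightarrow> ('n, 'r) monoid_scheme \<Rightarrow> ('h \<Rightarrow> ('n \<times> 'n) set) \<Rightarrow>
   ('h \<Rightarrow> 'n \<Rightarrow> 'n) \<Rightarrow> (('h \<Rightarrow> 'h \<Rightarrow> 'n) \<times> ('h \<Rightarrow> 'h \<Rightarrow> 'n)) set" where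
  "cohomologous H N E \<phi> =
     {(g, g'). g \<in> factor_sets H N E \<phi> \<and> g' \<in> factor_sets H N E \<phi> \<and>
        (\<exists>d \<in> inner_factor_sets H N \<phi>. \<forall>h \<in> carrier H. \<forall>h' \<in> carrier H.
           (d h h' \<otimes>\<^bsub>N\<^esub> g' h h', g h h') \<in> E (h \<otimes>\<^bsub>H\<^esub> h'))}"

text \<open>The class \<open>[g]\<^sub>E\<close>; it is empty when \<^term>\<open>g\<close> is not a factor set.\<close>

definition factor_class ::
  "('h, 's) monoid_scheme \<Rightarrow> ('n, 'r) monoid_scheme \<Rightarrow> ('h \<Rightarrow> ('n \<times> 'n) set) \<Rightarrow>
   ('h \<Rightarrow> 'n \<Rightarrow> 'n) \<Rightarrow> ('h \<Rightarrow> 'h \<Rightarrow> 'n) \<Rightarrow> ('h \<Rightarrow> 'h \<Rightarrow> 'n) set" where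
  "factor_class H N E \<phi> g = cohomologous H N E \<phi> `` {g}"

definition cohomology2 ::
  "('h, 's) monoid_scheme \<Rightarrow> ('n, 'r) monoid_scheme \<Rightarrow> ('h \<Rightarrow> ('n \<times> 'n) set) \<Rightarrow>
   ('h \<Rightarrow> 'n \<Rightarrow> 'n) \<Rightarrow> ('h \<Rightarrow> 'h \<Rightarrow> 'n) set monoid" where
  "cohomology2 H N E \<phi> =
     \<lparr>carrier = factor_sets H N E \<phi> // cohomologous H N E \<phi>,
      monoid.mult =
        (\<lambda>A B. \<Union>g\<in>A. \<Union>g'\<in>B. factor_class H N E \<phi> (\<lambda>h h'. g h h' \<otimes>\<^bsub>N\<^esub> g' h h')),
      one = factor_class H N E \<phi> (\<lambda>h h'. \<one>\<^bsub>N\<^esub>)\<rparr>"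


section \<open>Crossed products\<close>

definition crossed_product ::
  "('h, 's) monoid_scheme \<Rightarrow> ('n, 'r) monoid_scheme \<Rightarrow> ('h \<Rightarrow> ('n \<times> 'n) set) \<Rightarrow>
   ('h \<Rightarrow> 'n \<Rightarrow> 'n) \<Rightarrow> ('h \<Rightarrow> 'h \<Rightarrow> 'n) \<Rightarrow> ('n set \<times> 'h) monoid" where
  "crossed_product H N E \<phi> g =
     \<lparr>carrier = {(A, h). h \<in> carrier H \<and> A \<in> carrier N // E h},
      monoid.mult =
        (\<lambda>(A, h) (B, h').
           (\<Union>n\<in>A. \<Union>n'\<in>B. E (h \<otimes>\<^bsub>H\<^esub> h') `` {n \<otimes>\<^bsub>N\<^esub> \<phi> h n' \<otimes>\<^bsub>N\<^esub> g h h'}, h \<otimes>\<^bsub>H\<^esub> h')),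
      one = (E \<one>\<^bsub>H\<^esub> `` {\<one>\<^bsub>N\<^esub>}, \<one>\<^bsub>H\<^esub>)\<rparr>"

definition crossed_product_k ::
  "('h, 's) monoid_scheme \<Rightarrow> ('h \<Rightarrow> ('n \<times> 'n) set) \<Rightarrow> 'n \<Rightarrow> 'n set \<times> 'h" where
  "crossed_product_k H E n = (E \<one>\<^bsub>H\<^esub> `` {n}, \<one>\<^bsub>H\<^esub>)"

definition crossed_product_e :: "'n set \<times> 'h \<Rightarrow> 'h" where
  "crossed_product_e = snd"

text \<open>\<open>N \<rightarrow> G \<rightarrow> H\<close> corresponds to the class of \<open>g\<close> in the second cohomology group of
  \<open>(E, [\<phi>])\<close>.\<close>

definition corresponds_to ::
  "('n, 'r) monoid_scheme \<Rightarrow> ('n \<Rightarrow> 'a) \<Rightarrow> ('a, 'p) monoid_scheme \<Rightarrow> ('a \<Rightarrow> 'h) \<Rightarrow>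
   ('h, 's) monoid_scheme \<Rightarrow> ('h \<Rightarrow> ('n \<times> 'n) set) \<Rightarrow> ('h \<Rightarrow> 'n \<Rightarrow> 'n) \<Rightarrow>
   ('h \<Rightarrow> 'h \<Rightarrow> 'n) \<Rightarrow> bool" where
  "corresponds_to N k G e H E \<phi> g \<longleftrightarrow>
     extension_isomorphic N k G e
       (crossed_product_k H E) (crossed_product H N E \<phi> g) crossed_product_e"

end

theory Submission
  imports Defs
begin

text \<open>A crossed product is generated by the elements \<open>([n], 1)\<close> and \<open>([1], h)\<close>, because
  \<open>([n], h) = ([n], 1) ([1], h)\<close>.  A morphism of extensions \<open>F\<close> between two crossed products fixes
  the elements \<open>([n], 1)\<close> and maps \<open>([1], h)\<close> into the fibre over \<open>h\<close>, say to \<open>([t h], h)\<close>; hence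
  \<open>F ([n], h) = ([n t(h)], h)\<close>, and \<open>F\<close> is known once the cochain \<open>t\<close> is.  Conversely, a cochain
  \<open>t\<close> with \<open>t 1 = 1\<close> defines a morphism in this way exactly if

  \<^item> the formula is independent of the representative \<open>n\<close>; as \<open>t(h)\<close> is invertible, this says that
    the first indexed equivalence is contained in the second;
  \<^item> products \<open>([1], h) ([n], 1)\<close> are preserved; after cancelling \<open>t(h)\<close>, this says that the two
    actions agree modulo the second equivalence;
  \<^item> products \<open>([1], h) ([1], h')\<close> are preserved; this is the relation
    \<open>g\<^sub>1(h,h') \<sim> \<delta>t(h,h') g\<^sub>2(h,h')\<close>, so \<open>g\<^sub>1\<close> and \<open>g\<^sub>2\<close> are cohomologous for the second pair.

  The necessity of these conditions is \<open>crossed_product_morphism_imp\<close>, their sufficiency is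
  \<open>crossed_product_morphismI\<close>.  Arbitrary cosetal extensions are reduced to crossed products by
  composing with the given isomorphisms and their inverses.\<close>

section \<open>Morphisms of extensions\<close>

lemma extension_morphism_comp:
  assumes "extension_morphism N k\<^sub>1 G\<^sub>1 e\<^sub>1 k\<^sub>2 G\<^sub>2 e\<^sub>2 f"
    and "extension_morphism N k\<^sub>2 G\<^sub>2 e\<^sub>2 k\<^sub>3 G\<^sub>3 e\<^sub>3 f'"
  shows "extension_morphism N k\<^sub>1 G\<^sub>1 e\<^sub>1 k\<^sub>3 G\<^sub>3 e\<^sub>3 (f' \<circ> f)"
  using assms unfolding extension_morphism_def monoid_hom_def hom_def
  by (auto simp: Pi_iff)

lemma extension_morphism_inverse:
  assumes "monoid G\<^sub>1" and k: "k\<^sub>1 \<in> carrier N \<rightarrow> carrier G\<^sub>1"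
    and iso: "f \<in> iso G\<^sub>1 G\<^sub>2"
    and f: "extension_morphism N k\<^sub>1 G\<^sub>1 e\<^sub>1 k\<^sub>2 G\<^sub>2 e\<^sub>2 f"
  shows "extension_morphism N k\<^sub>2 G\<^sub>2 e\<^sub>2 k\<^sub>1 G\<^sub>1 e\<^sub>1 (inv_into (carrier G\<^sub>1) f)"
proof -
  interpret G\<^sub>1: monoid G\<^sub>1 by fact
  have bij: "bij_betw f (carrier G\<^sub>1) (carrier G\<^sub>2)"
    using iso by (simp add: iso_def)
  have surj: "\<exists>y\<in>carrier G\<^sub>1. x = f y" if "x \<in> carrier G\<^sub>2" for x
    using that bij_betw_imp_surj_on[OF bij] by blast
  have inv_f: "inv_into (carrier G\<^sub>1) f (f x) = x" if "x \<in> carrier G\<^sub>1" for x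
    using that bij by (auto simp: bij_betw_def)
  have "inv_into (carrier G\<^sub>1) f \<in> carrier G\<^sub>2 \<rightarrow> carrier G\<^sub>1"
    using bij_betw_inv_into[OF bij] by (auto simp: bij_betw_def)
  moreover have "inv_into (carrier G\<^sub>1) f (x \<otimes>\<^bsub>G\<^sub>2\<^esub> y) =
      inv_into (carrier G\<^sub>1) f x \<otimes>\<^bsub>G\<^sub>1\<^esub> inv_into (carrier G\<^sub>1) f y"
    if xy: "x \<in> carrier G\<^sub>2" "y \<in> carrier G\<^sub>2" for x y
  proof -
    obtain a b where ab: "a \<in> carrier G\<^sub>1" "b \<in> carrier G\<^sub>1" "x = f a" "y = f b"
      using surj[OF xy(1)] surj[OF xy(2)] by blast
    then have "x \<otimes>\<^bsub>G\<^sub>2\<^esub> y = f (a \<otimes>\<^bsub>G\<^sub>1\<^esub> b)"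
      using f by (simp add: extension_morphism_def monoid_hom_def hom_def)
    with ab inv_f show ?thesis by simp
  qed
  moreover have "inv_into (carrier G\<^sub>1) f \<one>\<^bsub>G\<^sub>2\<^esub> = \<one>\<^bsub>G\<^sub>1\<^esub>"
    using f inv_f[OF G\<^sub>1.one_closed] by (simp add: extension_morphism_def monoid_hom_def)
  moreover have "inv_into (carrier G\<^sub>1) f (k\<^sub>2 n) = k\<^sub>1 n" if "n \<in> carrier N" for n
    using f inv_f[of "k\<^sub>1 n"] k that by (auto simp: extension_morphism_def)
  moreover have "e\<^sub>1 (inv_into (carrier G\<^sub>1) f x) = e\<^sub>2 x" if "x \<in> carrier G\<^sub>2" for x
  proof -
    obtain y where "y \<in> carrier G\<^sub>1" "x = f y"
      using surj[OF \<open>x \<in> carrier G\<^sub>2\<close>] by blast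
    then show ?thesis
      using f inv_f by (simp add: extension_morphism_def)
  qed
  ultimately show ?thesis
    by (simp add: extension_morphism_def monoid_hom_def hom_def)
qed

lemma extension_morphism_iff_of_isomorphic:
  assumes "extension N k\<^sub>1 G\<^sub>1 e\<^sub>1 H" and "extension N k\<^sub>2 G\<^sub>2 e\<^sub>2 H"
    and "extension_isomorphic N k\<^sub>1 G\<^sub>1 e\<^sub>1 k\<^sub>1' G\<^sub>1' e\<^sub>1'"
    and "extension_isomorphic N k\<^sub>2 G\<^sub>2 e\<^sub>2 k\<^sub>2' G\<^sub>2' e\<^sub>2'"
  shows "(\<exists>f. extension_morphism N k\<^sub>1 G\<^sub>1 e\<^sub>1 k\<^sub>2 G\<^sub>2 e\<^sub>2 f) \<longleftrightarrow>
    (\<exists>f. extension_morphism N k\<^sub>1' G\<^sub>1' e\<^sub>1' k\<^sub>2' G\<^sub>2' e\<^sub>2' f)"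
proof -
  have ext: "monoid G\<^sub>1" "k\<^sub>1 \<in> carrier N \<rightarrow> carrier G\<^sub>1" "monoid G\<^sub>2" "k\<^sub>2 \<in> carrier N \<rightarrow> carrier G\<^sub>2"
    using assms(1,2) by (auto simp: extension_def monoid_hom_def hom_def)
  obtain i\<^sub>1 where i\<^sub>1: "i\<^sub>1 \<in> iso G\<^sub>1 G\<^sub>1'" "extension_morphism N k\<^sub>1 G\<^sub>1 e\<^sub>1 k\<^sub>1' G\<^sub>1' e\<^sub>1' i\<^sub>1"
    using assms(3) by (auto simp: extension_isomorphic_def)
  obtain i\<^sub>2 where i\<^sub>2: "i\<^sub>2 \<in> iso G\<^sub>2 G\<^sub>2'" "extension_morphism N k\<^sub>2 G\<^sub>2 e\<^sub>2 k\<^sub>2' G\<^sub>2' e\<^sub>2' i\<^sub>2"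
    using assms(4) by (auto simp: extension_isomorphic_def)
  note j\<^sub>1 = extension_morphism_inverse[OF ext(1,2) i\<^sub>1]
    and j\<^sub>2 = extension_morphism_inverse[OF ext(3,4) i\<^sub>2]
  show ?thesis
  proof (intro iffI; elim exE)
    fix f assume f: "extension_morphism N k\<^sub>1 G\<^sub>1 e\<^sub>1 k\<^sub>2 G\<^sub>2 e\<^sub>2 f"
    show "\<exists>f. extension_morphism N k\<^sub>1' G\<^sub>1' e\<^sub>1' k\<^sub>2' G\<^sub>2' e\<^sub>2' f"
      by (rule exI, rule extension_morphism_comp[OF j\<^sub>1 extension_morphism_comp[OF f i\<^sub>2(2)]])
  next
    fix f assume f: "extension_morphism N k\<^sub>1' G\<^sub>1' e\<^sub>1' k\<^sub>2' G\<^sub>2' e\<^sub>2' f"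
    show "\<exists>f. extension_morphism N k\<^sub>1 G\<^sub>1 e\<^sub>1 k\<^sub>2 G\<^sub>2 e\<^sub>2 f"
      by (rule exI, rule extension_morphism_comp[OF i\<^sub>1(2) extension_morphism_comp[OF f j\<^sub>2]])
  qed
qed


section \<open>Calculating modulo a compatible pair\<close>

locale compatible_pair_on =
  H: monoid H + N: comm_group N
  for H :: "('h, 's) monoid_scheme" and N :: "('n, 'r) monoid_scheme" +
  fixes E :: "'h \<Rightarrow> ('n \<times> 'n) set" and \<phi> :: "'h \<Rightarrow> 'n \<Rightarrow> 'n"
  assumes pair: "compatible_pair H N E \<phi>"
begin

lemma equiv_E: "h \<in> carrier H \<Longrightarrow> equiv (carrier N) (E h)"
  using pair by (simp add: compatible_pair_def admissible_def indexed_equiv_def)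

lemma E_refl: "h \<in> carrier H \<Longrightarrow> n \<in> carrier N \<Longrightarrow> (n, n) \<in> E h"
  using equiv_E[of h] unfolding equiv_def refl_on_def by blast

lemma E_sym: "(a, b) \<in> E h \<Longrightarrow> h \<in> carrier H \<Longrightarrow> (b, a) \<in> E h"
  using equiv_E[of h] unfolding equiv_def sym_def by blast

lemma E_trans: "(a, b) \<in> E h \<Longrightarrow> (b, c) \<in> E h \<Longrightarrow> h \<in> carrier H \<Longrightarrow> (a, c) \<in> E h"
  using equiv_E[of h] unfolding equiv_def trans_def by blast

lemma E_closed: "(a, b) \<in> E h \<Longrightarrow> h \<in> carrier H \<Longrightarrow> a \<in> carrier N \<and> b \<in> carrier N"
  using equiv_E[of h] unfolding equiv_def by blast

lemma class_eq_iff: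
  "h \<in> carrier H \<Longrightarrow> a \<in> carrier N \<Longrightarrow> b \<in> carrier N \<Longrightarrow> E h `` {a} = E h `` {b} \<longleftrightarrow> (a, b) \<in> E h"
  by (simp add: eq_equiv_class_iff[OF equiv_E])

lemma E_one: "(a, b) \<in> E \<one>\<^bsub>H\<^esub> \<Longrightarrow> a = b"
  using pair E_closed[of a b "\<one>\<^bsub>H\<^esub>"] by (simp add: compatible_pair_def admissible_def)

lemma E_mult_left:
  "(a, b) \<in> E h \<Longrightarrow> h \<in> carrier H \<Longrightarrow> x \<in> carrier N \<Longrightarrow> (x \<otimes>\<^bsub>N\<^esub> a, x \<otimes>\<^bsub>N\<^esub> b) \<in> E h"
  using pair E_closed[of a b h] by (simp add: compatible_pair_def admissible_def)

lemma E_mult: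
  assumes "(a, b) \<in> E h" and "(c, d) \<in> E h" and h: "h \<in> carrier H"
  shows "(a \<otimes>\<^bsub>N\<^esub> c, b \<otimes>\<^bsub>N\<^esub> d) \<in> E h"
proof -
  have abcd: "a \<in> carrier N" "b \<in> carrier N" "c \<in> carrier N" "d \<in> carrier N"
    using assms E_closed by auto
  have "(c \<otimes>\<^bsub>N\<^esub> a, c \<otimes>\<^bsub>N\<^esub> b) \<in> E h" and "(b \<otimes>\<^bsub>N\<^esub> c, b \<otimes>\<^bsub>N\<^esub> d) \<in> E h"
    using assms abcd E_mult_left by auto
  then show ?thesis
    using abcd h E_trans by (simp add: N.m_comm)
qed

lemma E_mult_cancel:
  assumes "(x \<otimes>\<^bsub>N\<^esub> a, x \<otimes>\<^bsub>N\<^esub> b) \<in> E h" and "h \<in> carrier H"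
    and "x \<in> carrier N" "a \<in> carrier N" "b \<in> carrier N"
  shows "(a, b) \<in> E h"
  using E_mult_left[OF assms(1,2), of "inv\<^bsub>N\<^esub> x"] assms(3-) by (simp add: N.m_assoc[symmetric])

lemma E_extend:
  "(a, b) \<in> E h \<Longrightarrow> h \<in> carrier H \<Longrightarrow> y \<in> carrier H \<Longrightarrow> (a, b) \<in> E (h \<otimes>\<^bsub>H\<^esub> y)"
  using pair E_closed[of a b h] by (simp add: compatible_pair_def admissible_def)

lemma action_funcset: "\<phi> \<in> carrier H \<rightarrow> carrier N \<rightarrow> carrier N"
  using pair by (simp add: compatible_pair_def compatible_action_def)

lemma action_closed [simp]: "h \<in> carrier H \<Longrightarrow> n \<in> carrier N \<Longrightarrow> \<phi> h n \<in> carrier N"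
  using action_funcset by blast

lemma action_cong:
  "(a, b) \<in> E h \<Longrightarrow> h \<in> carrier H \<Longrightarrow> x \<in> carrier H \<Longrightarrow> (\<phi> x a, \<phi> x b) \<in> E (x \<otimes>\<^bsub>H\<^esub> h)"
  using pair E_closed[of a b h] by (simp add: compatible_pair_def compatible_action_def)

lemma action_mult:
  "h \<in> carrier H \<Longrightarrow> a \<in> carrier N \<Longrightarrow> b \<in> carrier N \<Longrightarrow>
    (\<phi> h (a \<otimes>\<^bsub>N\<^esub> b), \<phi> h a \<otimes>\<^bsub>N\<^esub> \<phi> h b) \<in> E h"
  using pair by (simp add: compatible_pair_def compatible_action_def)

lemma action_unit: "h \<in> carrier H \<Longrightarrow> (\<phi> h \<one>\<^bsub>N\<^esub>, \<one>\<^bsub>N\<^esub>) \<in> E h"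
  using pair by (simp add: compatible_pair_def compatible_action_def)

lemma one_action [simp]: "n \<in> carrier N \<Longrightarrow> \<phi> \<one>\<^bsub>H\<^esub> n = n"
  using pair by (intro E_one) (simp add: compatible_pair_def compatible_action_def)

lemma action_inv:
  assumes h: "h \<in> carrier H" and a: "a \<in> carrier N"
  shows "(\<phi> h (inv\<^bsub>N\<^esub> a), inv\<^bsub>N\<^esub> (\<phi> h a)) \<in> E h"
proof -
  have "(\<phi> h \<one>\<^bsub>N\<^esub>, \<phi> h a \<otimes>\<^bsub>N\<^esub> \<phi> h (inv\<^bsub>N\<^esub> a)) \<in> E h"
    using action_mult[of h a "inv\<^bsub>N\<^esub> a"] h a by simp
  then have "(\<phi> h a \<otimes>\<^bsub>N\<^esub> \<phi> h (inv\<^bsub>N\<^esub> a), \<one>\<^bsub>N\<^esub>) \<in> E h"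
    using action_unit[OF h] h by (blast intro: E_sym E_trans)
  then have "(\<phi> h a \<otimes>\<^bsub>N\<^esub> \<phi> h (inv\<^bsub>N\<^esub> a), \<phi> h a \<otimes>\<^bsub>N\<^esub> inv\<^bsub>N\<^esub> (\<phi> h a)) \<in> E h"
    using h a by simp
  then show ?thesis
    by (rule E_mult_cancel) (use h a in auto)
qed

lemma action_class_eq_iff:
  assumes "\<psi> \<in> carrier H \<rightarrow> carrier N \<rightarrow> carrier N"
  shows "action_class H N E \<psi> = action_class H N E \<phi> \<longleftrightarrow>
    (\<forall>h\<in>carrier H. \<forall>n\<in>carrier N. (\<psi> h n, \<phi> h n) \<in> E h)"
    (is "?L \<longleftrightarrow> ?R")
proof
  assume ?L
  moreover have "\<phi> \<in> action_class H N E \<phi>"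
    using action_funcset E_refl by (simp add: action_class_def action_rel_def)
  ultimately have "\<phi> \<in> action_class H N E \<psi>" by simp
  then show ?R by (simp add: action_class_def action_rel_def)
next
  assume R: ?R
  have "(\<forall>h\<in>carrier H. \<forall>n\<in>carrier N. (\<psi> h n, \<chi> h n) \<in> E h) \<longleftrightarrow>
      (\<forall>h\<in>carrier H. \<forall>n\<in>carrier N. (\<phi> h n, \<chi> h n) \<in> E h)" for \<chi>
    using R E_sym E_trans by meson
  then show ?L
    using action_funcset assms by (simp add: action_class_def action_rel_def)
qed


section \<open>The relation of being cohomologous\<close>

lemma factor_set_closed [simp]:
  "g \<in> factor_sets H N E \<phi> \<Longrightarrow> h \<in> carrier H \<Longrightarrow> h' \<in> carrier H \<Longrightarrow> g h h' \<in> carrier N"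
  unfolding factor_sets_def by blast

lemma factor_set_one_right:
  "g \<in> factor_sets H N E \<phi> \<Longrightarrow> h \<in> carrier H \<Longrightarrow> (g h \<one>\<^bsub>H\<^esub>, \<one>\<^bsub>N\<^esub>) \<in> E h"
  unfolding factor_sets_def by blast

lemma factor_set_one_left:
  "g \<in> factor_sets H N E \<phi> \<Longrightarrow> h \<in> carrier H \<Longrightarrow> (g \<one>\<^bsub>H\<^esub> h, \<one>\<^bsub>N\<^esub>) \<in> E h"
  unfolding factor_sets_def using E_sym by blast

lemma factor_set_cocycle:
  "g \<in> factor_sets H N E \<phi> \<Longrightarrow> x \<in> carrier H \<Longrightarrow> y \<in> carrier H \<Longrightarrow> z \<in> carrier H \<Longrightarrow>
    (g x y \<otimes>\<^bsub>N\<^esub> g (x \<otimes>\<^bsub>H\<^esub> y) z, \<phi> x (g y z) \<otimes>\<^bsub>N\<^esub> g x (y \<otimes>\<^bsub>H\<^esub> z)) \<in> E (x \<otimes>\<^bsub>H\<^esub> y \<otimes>\<^bsub>H\<^esub> z)"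
  unfolding factor_sets_def by blast

lemma cohomologous_iff:
  "(g, g') \<in> cohomologous H N E \<phi> \<longleftrightarrow>
    g \<in> factor_sets H N E \<phi> \<and> g' \<in> factor_sets H N E \<phi> \<and>
    (\<exists>t \<in> carrier H \<rightarrow> carrier N. t \<one>\<^bsub>H\<^esub> = \<one>\<^bsub>N\<^esub> \<and>
      (\<forall>h \<in> carrier H. \<forall>h' \<in> carrier H.
        (coboundary H N \<phi> t h h' \<otimes>\<^bsub>N\<^esub> g' h h', g h h') \<in> E (h \<otimes>\<^bsub>H\<^esub> h')))"
  unfolding cohomologous_def inner_factor_sets_def by blast

lemma coboundary_closed [simp]:
  "t \<in> carrier H \<rightarrow> carrier N \<Longrightarrow> h \<in> carrier H \<Longrightarrow> h' \<in> carrier H \<Longrightarrow>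
    coboundary H N \<phi> t h h' \<in> carrier N"
  by (simp add: coboundary_def Pi_iff)

text \<open>Modulo \<open>E\<close> the action is by homomorphisms, so taking coboundaries is a homomorphism as
  well.  Hence being cohomologous is symmetric and transitive, by inverting and multiplying cochains
  pointwise.\<close>

lemma coboundary_mult:
  assumes t: "t \<in> carrier H \<rightarrow> carrier N" and u: "u \<in> carrier H \<rightarrow> carrier N"
    and h: "h \<in> carrier H" and h': "h' \<in> carrier H"
  shows "(coboundary H N \<phi> (\<lambda>x. t x \<otimes>\<^bsub>N\<^esub> u x) h h',
    coboundary H N \<phi> t h h' \<otimes>\<^bsub>N\<^esub> coboundary H N \<phi> u h h') \<in> E (h \<otimes>\<^bsub>H\<^esub> h')"
proof -
  have hh': "h \<otimes>\<^bsub>H\<^esub> h' \<in> carrier H" using h h' by simp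
  have tu: "t x \<in> carrier N" "u x \<in> carrier N" if "x \<in> carrier H" for x
    using that t u by auto
  note cl = tu[OF h] tu[OF h'] tu[OF hh'] h
  have "(\<phi> h (t h' \<otimes>\<^bsub>N\<^esub> u h'), \<phi> h (t h') \<otimes>\<^bsub>N\<^esub> \<phi> h (u h')) \<in> E (h \<otimes>\<^bsub>H\<^esub> h')"
    using cl h' by (intro E_extend action_mult)
  then have "(\<phi> h (t h' \<otimes>\<^bsub>N\<^esub> u h') \<otimes>\<^bsub>N\<^esub>
        (inv\<^bsub>N\<^esub> (t (h \<otimes>\<^bsub>H\<^esub> h') \<otimes>\<^bsub>N\<^esub> u (h \<otimes>\<^bsub>H\<^esub> h')) \<otimes>\<^bsub>N\<^esub> (t h \<otimes>\<^bsub>N\<^esub> u h)),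
      \<phi> h (t h') \<otimes>\<^bsub>N\<^esub> \<phi> h (u h') \<otimes>\<^bsub>N\<^esub>
        (inv\<^bsub>N\<^esub> (t (h \<otimes>\<^bsub>H\<^esub> h') \<otimes>\<^bsub>N\<^esub> u (h \<otimes>\<^bsub>H\<^esub> h')) \<otimes>\<^bsub>N\<^esub> (t h \<otimes>\<^bsub>N\<^esub> u h))) \<in> E (h \<otimes>\<^bsub>H\<^esub> h')"
    using cl hh' by (intro E_mult E_refl) auto
  then show ?thesis
    using cl by (simp add: coboundary_def N.inv_mult N.m_ac)
qed

lemma coboundary_inv:
  assumes t: "t \<in> carrier H \<rightarrow> carrier N"
    and h: "h \<in> carrier H" and h': "h' \<in> carrier H"
  shows "(coboundary H N \<phi> (\<lambda>x. inv\<^bsub>N\<^esub> (t x)) h h', inv\<^bsub>N\<^esub> (coboundary H N \<phi> t h h'))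
    \<in> E (h \<otimes>\<^bsub>H\<^esub> h')"
proof -
  have hh': "h \<otimes>\<^bsub>H\<^esub> h' \<in> carrier H" using h h' by simp
  have t': "t x \<in> carrier N" if "x \<in> carrier H" for x
    using that t by auto
  note cl = t'[OF h] t'[OF h'] t'[OF hh'] h
  have "(\<phi> h (inv\<^bsub>N\<^esub> (t h')), inv\<^bsub>N\<^esub> (\<phi> h (t h'))) \<in> E (h \<otimes>\<^bsub>H\<^esub> h')"
    using cl h' by (intro E_extend action_inv)
  then have "(\<phi> h (inv\<^bsub>N\<^esub> (t h')) \<otimes>\<^bsub>N\<^esub> (t (h \<otimes>\<^bsub>H\<^esub> h') \<otimes>\<^bsub>N\<^esub> inv\<^bsub>N\<^esub> (t h)),
      inv\<^bsub>N\<^esub> (\<phi> h (t h')) \<otimes>\<^bsub>N\<^esub> (t (h \<otimes>\<^bsub>H\<^esub> h') \<otimes>\<^bsub>N\<^esub> inv\<^bsub>N\<^esub> (t h))) \<in> E (h \<otimes>\<^bsub>H\<^esub> h')"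
    using cl hh' by (intro E_mult E_refl) auto
  then show ?thesis
    using cl by (simp add: coboundary_def N.inv_mult N.m_ac)
qed

lemma coboundary_trivial:
  assumes "h \<in> carrier H" and "h' \<in> carrier H"
  shows "(coboundary H N \<phi> (\<lambda>_. \<one>\<^bsub>N\<^esub>) h h', \<one>\<^bsub>N\<^esub>) \<in> E (h \<otimes>\<^bsub>H\<^esub> h')"
  using E_extend[OF action_unit, of h h'] assms by (simp add: coboundary_def)

lemma equiv_cohomologous: "equiv (factor_sets H N E \<phi>) (cohomologous H N E \<phi>)"
proof (rule equivI)
  show "cohomologous H N E \<phi> \<subseteq> factor_sets H N E \<phi> \<times> factor_sets H N E \<phi>"
    by (auto simp: cohomologous_def)
  show "refl_on (factor_sets H N E \<phi>) (cohomologous H N E \<phi>)"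
  proof (rule refl_onI)
    fix g assume g: "g \<in> factor_sets H N E \<phi>"
    have "(coboundary H N \<phi> (\<lambda>_. \<one>\<^bsub>N\<^esub>) h h' \<otimes>\<^bsub>N\<^esub> g h h', g h h') \<in> E (h \<otimes>\<^bsub>H\<^esub> h')"
      if "h \<in> carrier H" "h' \<in> carrier H" for h h'
      using E_mult[OF coboundary_trivial E_refl, of h h' "g h h'"] that g by simp
    then show "(g, g) \<in> cohomologous H N E \<phi>"
      using g unfolding cohomologous_iff by (auto intro!: bexI[of _ "\<lambda>_. \<one>\<^bsub>N\<^esub>"])
  qed
  show "sym (cohomologous H N E \<phi>)"
  proof (rule symI)
    fix g g' assume "(g, g') \<in> cohomologous H N E \<phi>"
    then obtain t where g: "g \<in> factor_sets H N E \<phi>" "g' \<in> factor_sets H N E \<phi>"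
      and t: "t \<in> carrier H \<rightarrow> carrier N" "t \<one>\<^bsub>H\<^esub> = \<one>\<^bsub>N\<^esub>"
      and eq: "\<And>h h'. h \<in> carrier H \<Longrightarrow> h' \<in> carrier H \<Longrightarrow>
        (coboundary H N \<phi> t h h' \<otimes>\<^bsub>N\<^esub> g' h h', g h h') \<in> E (h \<otimes>\<^bsub>H\<^esub> h')"
      unfolding cohomologous_iff by blast
    have "(coboundary H N \<phi> (\<lambda>x. inv\<^bsub>N\<^esub> (t x)) h h' \<otimes>\<^bsub>N\<^esub> g h h', g' h h') \<in> E (h \<otimes>\<^bsub>H\<^esub> h')"
      if h: "h \<in> carrier H" "h' \<in> carrier H" for h h'
    proof -
      have "(coboundary H N \<phi> (\<lambda>x. inv\<^bsub>N\<^esub> (t x)) h h' \<otimes>\<^bsub>N\<^esub> g h h',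
          inv\<^bsub>N\<^esub> (coboundary H N \<phi> t h h') \<otimes>\<^bsub>N\<^esub> (coboundary H N \<phi> t h h' \<otimes>\<^bsub>N\<^esub> g' h h'))
        \<in> E (h \<otimes>\<^bsub>H\<^esub> h')"
        using h t by (intro E_mult coboundary_inv E_sym[OF eq]) auto
      then show ?thesis
        using h t g by (simp add: N.m_assoc[symmetric])
    qed
    then show "(g', g) \<in> cohomologous H N E \<phi>"
      using g t unfolding cohomologous_iff by (auto intro!: bexI[of _ "\<lambda>x. inv\<^bsub>N\<^esub> (t x)"])
  qed
  show "trans (cohomologous H N E \<phi>)"
  proof (rule transI)
    fix g g' g''
    assume "(g, g') \<in> cohomologous H N E \<phi>" "(g', g'') \<in> cohomologous H N E \<phi>"
    then obtain t u where g: "g \<in> factor_sets H N E \<phi>" "g' \<in> factor_sets H N E \<phi>"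
        "g'' \<in> factor_sets H N E \<phi>"
      and t: "t \<in> carrier H \<rightarrow> carrier N" "t \<one>\<^bsub>H\<^esub> = \<one>\<^bsub>N\<^esub>"
      and eq: "\<And>h h'. h \<in> carrier H \<Longrightarrow> h' \<in> carrier H \<Longrightarrow>
        (coboundary H N \<phi> t h h' \<otimes>\<^bsub>N\<^esub> g' h h', g h h') \<in> E (h \<otimes>\<^bsub>H\<^esub> h')"
      and u: "u \<in> carrier H \<rightarrow> carrier N" "u \<one>\<^bsub>H\<^esub> = \<one>\<^bsub>N\<^esub>"
      and eq': "\<And>h h'. h \<in> carrier H \<Longrightarrow> h' \<in> carrier H \<Longrightarrow>
        (coboundary H N \<phi> u h h' \<otimes>\<^bsub>N\<^esub> g'' h h', g' h h') \<in> E (h \<otimes>\<^bsub>H\<^esub> h')"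
      unfolding cohomologous_iff by blast
    have "(coboundary H N \<phi> (\<lambda>x. t x \<otimes>\<^bsub>N\<^esub> u x) h h' \<otimes>\<^bsub>N\<^esub> g'' h h', g h h') \<in> E (h \<otimes>\<^bsub>H\<^esub> h')"
      if h: "h \<in> carrier H" "h' \<in> carrier H" for h h'
    proof -
      have hh': "h \<otimes>\<^bsub>H\<^esub> h' \<in> carrier H" using h by simp
      have "(coboundary H N \<phi> (\<lambda>x. t x \<otimes>\<^bsub>N\<^esub> u x) h h' \<otimes>\<^bsub>N\<^esub> g'' h h',
          coboundary H N \<phi> t h h' \<otimes>\<^bsub>N\<^esub> coboundary H N \<phi> u h h' \<otimes>\<^bsub>N\<^esub> g'' h h') \<in> E (h \<otimes>\<^bsub>H\<^esub> h')"
        using h t u g by (intro E_mult coboundary_mult E_refl) auto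
      moreover have "(coboundary H N \<phi> t h h' \<otimes>\<^bsub>N\<^esub> coboundary H N \<phi> u h h' \<otimes>\<^bsub>N\<^esub> g'' h h',
          coboundary H N \<phi> t h h' \<otimes>\<^bsub>N\<^esub> g' h h') \<in> E (h \<otimes>\<^bsub>H\<^esub> h')"
        using E_mult_left[OF eq'[OF h] hh', of "coboundary H N \<phi> t h h'"] h t u g
        by (simp add: N.m_assoc)
      ultimately show ?thesis
        using eq[OF h] hh' E_trans by blast
    qed
    then show "(g, g'') \<in> cohomologous H N E \<phi>"
      using g t u unfolding cohomologous_iff
      by (auto intro!: bexI[of _ "\<lambda>x. t x \<otimes>\<^bsub>N\<^esub> u x"])
  qed
qed

text \<open>The class of a map which is not a factor set is empty, whereas every element of the second
  cohomology group contains a factor set.\<close>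

lemma factor_set_of_class:
  assumes "factor_class H N E \<phi> g \<in> carrier (cohomology2 H N E \<phi>)"
  shows "g \<in> factor_sets H N E \<phi>"
proof -
  have "factor_class H N E \<phi> g \<noteq> {}"
    using assms in_quotient_imp_non_empty[OF equiv_cohomologous]
    by (auto simp: cohomology2_def)
  then show ?thesis
    by (auto simp: factor_class_def cohomologous_def)
qed

lemma factor_class_eq_iff:
  assumes "g' \<in> factor_sets H N E \<phi>"
  shows "factor_class H N E \<phi> g = factor_class H N E \<phi> g' \<longleftrightarrow> (g, g') \<in> cohomologous H N E \<phi>"
  using assms equiv_class_eq[OF equiv_cohomologous] eq_equiv_class[OF _ equiv_cohomologous]
  unfolding factor_class_def by blast

end


section \<open>Crossed products\<close>

locale factor_set_on = compatible_pair_on H N E \<phi>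
  for H :: "('h, 's) monoid_scheme" and N :: "('n, 'r) monoid_scheme"
    and E :: "'h \<Rightarrow> ('n \<times> 'n) set" and \<phi> :: "'h \<Rightarrow> 'n \<Rightarrow> 'n" +
  fixes g :: "'h \<Rightarrow> 'h \<Rightarrow> 'n"
  assumes factor_set: "g \<in> factor_sets H N E \<phi>"
begin

abbreviation "CP \<equiv> crossed_product H N E \<phi> g"

abbreviation elt :: "'n \<Rightarrow> 'h \<Rightarrow> 'n set \<times> 'h" where
  "elt n h \<equiv> (E h `` {n}, h)"

lemma g_closed [simp]: "h \<in> carrier H \<Longrightarrow> h' \<in> carrier H \<Longrightarrow> g h h' \<in> carrier N"
  using factor_set by simp

lemma elt_closed: "n \<in> carrier N \<Longrightarrow> h \<in> carrier H \<Longrightarrow> elt n h \<in> carrier CP"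
  by (simp add: crossed_product_def quotientI)

lemma crossed_product_cases:
  assumes "x \<in> carrier CP"
  obtains n h where "n \<in> carrier N" and "h \<in> carrier H" and "x = elt n h"
  using assms by (auto simp: crossed_product_def quotient_def)

lemma elt_mult:
  assumes n: "n \<in> carrier N" "n' \<in> carrier N" and h: "h \<in> carrier H" "h' \<in> carrier H"
  shows "elt n h \<otimes>\<^bsub>CP\<^esub> elt n' h' = elt (n \<otimes>\<^bsub>N\<^esub> \<phi> h n' \<otimes>\<^bsub>N\<^esub> g h h') (h \<otimes>\<^bsub>H\<^esub> h')"
proof -
  let ?c = "\<lambda>a b. E (h \<otimes>\<^bsub>H\<^esub> h') `` {a \<otimes>\<^bsub>N\<^esub> \<phi> h b \<otimes>\<^bsub>N\<^esub> g h h'}"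
  have const: "?c a b = ?c n n'" if a: "a \<in> E h `` {n}" and b: "b \<in> E h' `` {n'}" for a b
  proof -
    have ab: "(a, n) \<in> E h" "(b, n') \<in> E h'"
      using a b h E_sym by auto
    have "a \<in> carrier N" "b \<in> carrier N"
      using E_closed ab h by auto
    moreover have "(a \<otimes>\<^bsub>N\<^esub> \<phi> h b \<otimes>\<^bsub>N\<^esub> g h h', n \<otimes>\<^bsub>N\<^esub> \<phi> h n' \<otimes>\<^bsub>N\<^esub> g h h') \<in> E (h \<otimes>\<^bsub>H\<^esub> h')"
      using ab h by (intro E_mult E_refl E_extend[OF ab(1)] action_cong[OF ab(2)]) auto
    ultimately show ?thesis
      using n h by (simp add: class_eq_iff)
  qed
  have "n \<in> E h `` {n}" "n' \<in> E h' `` {n'}"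
    using n h E_refl by auto
  with const have "(\<Union>a\<in>E h `` {n}. \<Union>b\<in>E h' `` {n'}. ?c a b) = ?c n n'"
    by blast
  then show ?thesis
    by (simp add: crossed_product_def)
qed

text \<open>Up to normalization, the general product formula shows one ingredient at a time on the
  generators: multiplication in \<open>N\<close>, the action, and the factor set.  These three products
  determine which conditions a morphism has to satisfy.\<close>

lemma kernel_mult_elt:
  assumes n: "n \<in> carrier N" and h: "h \<in> carrier H" and m: "m \<in> carrier N"
  shows "elt n \<one>\<^bsub>H\<^esub> \<otimes>\<^bsub>CP\<^esub> elt m h = elt (n \<otimes>\<^bsub>N\<^esub> m) h"
proof -
  have "(n \<otimes>\<^bsub>N\<^esub> m \<otimes>\<^bsub>N\<^esub> g \<one>\<^bsub>H\<^esub> h, n \<otimes>\<^bsub>N\<^esub> m \<otimes>\<^bsub>N\<^esub> \<one>\<^bsub>N\<^esub>) \<in> E h"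
    using n h m factor_set by (intro E_mult E_refl factor_set_one_left) auto
  then show ?thesis
    using n h m by (simp add: elt_mult class_eq_iff)
qed

lemma elt_mult_kernel:
  assumes m: "m \<in> carrier N" and n: "n \<in> carrier N" and h: "h \<in> carrier H"
  shows "elt m h \<otimes>\<^bsub>CP\<^esub> elt n \<one>\<^bsub>H\<^esub> = elt (m \<otimes>\<^bsub>N\<^esub> \<phi> h n) h"
proof -
  have "(m \<otimes>\<^bsub>N\<^esub> \<phi> h n \<otimes>\<^bsub>N\<^esub> g h \<one>\<^bsub>H\<^esub>, m \<otimes>\<^bsub>N\<^esub> \<phi> h n \<otimes>\<^bsub>N\<^esub> \<one>\<^bsub>N\<^esub>) \<in> E h"
    using m n h factor_set by (intro E_mult E_refl factor_set_one_right) auto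
  then show ?thesis
    using m n h by (simp add: elt_mult class_eq_iff)
qed

lemma elt_mult_section:
  assumes h: "h \<in> carrier H" "h' \<in> carrier H"
  shows "elt \<one>\<^bsub>N\<^esub> h \<otimes>\<^bsub>CP\<^esub> elt \<one>\<^bsub>N\<^esub> h' = elt (g h h') (h \<otimes>\<^bsub>H\<^esub> h')"
proof -
  have "(\<one>\<^bsub>N\<^esub> \<otimes>\<^bsub>N\<^esub> \<phi> h \<one>\<^bsub>N\<^esub> \<otimes>\<^bsub>N\<^esub> g h h', \<one>\<^bsub>N\<^esub> \<otimes>\<^bsub>N\<^esub> \<one>\<^bsub>N\<^esub> \<otimes>\<^bsub>N\<^esub> g h h') \<in> E (h \<otimes>\<^bsub>H\<^esub> h')"
    using h by (intro E_mult E_refl E_extend[OF action_unit]) auto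
  then show ?thesis
    using h by (simp add: elt_mult class_eq_iff)
qed

end


section \<open>Morphisms between crossed products\<close>

locale two_crossed_products =
  P\<^sub>1: factor_set_on H N E\<^sub>1 \<phi>\<^sub>1 g\<^sub>1 + P\<^sub>2: factor_set_on H N E\<^sub>2 \<phi>\<^sub>2 g\<^sub>2
  for H :: "('h, 's) monoid_scheme" and N :: "('n, 'r) monoid_scheme"
    and E\<^sub>1 E\<^sub>2 :: "'h \<Rightarrow> ('n \<times> 'n) set" and \<phi>\<^sub>1 \<phi>\<^sub>2 :: "'h \<Rightarrow> 'n \<Rightarrow> 'n"
    and g\<^sub>1 g\<^sub>2 :: "'h \<Rightarrow> 'h \<Rightarrow> 'n"
begin

abbreviation crossed_product_morphism :: "('n set \<times> 'h \<Rightarrow> 'n set \<times> 'h) \<Rightarrow> bool" where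
  "crossed_product_morphism \<equiv>
    extension_morphism N (crossed_product_k H E\<^sub>1) P\<^sub>1.CP crossed_product_e
      (crossed_product_k H E\<^sub>2) P\<^sub>2.CP crossed_product_e"

text \<open>The inclusion of the equivalences carries the cocycle condition for the first pair over to
  \<open>E\<^sub>2\<close>, still with the action \<open>\<phi>\<^sub>1\<close>; the action can be exchanged because \<open>\<phi>\<^sub>1(x, g\<^sub>1(y,z)) \<sim> \<phi>\<^sub>2(x, g\<^sub>1(y,z))\<close>
  holds at \<open>x\<close> and hence at \<open>xyz\<close>.\<close>

lemma factor_set_mono:
  assumes le: "pair_le H N E\<^sub>1 \<phi>\<^sub>1 E\<^sub>2 \<phi>\<^sub>2"
  shows "g\<^sub>1 \<in> factor_sets H N E\<^sub>2 \<phi>\<^sub>2"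
proof -
  have sub: "(a, b) \<in> E\<^sub>2 h" if "(a, b) \<in> E\<^sub>1 h" "h \<in> carrier H" for a b h
    using le that by (auto simp: pair_le_def)
  have act: "(\<phi>\<^sub>1 h n, \<phi>\<^sub>2 h n) \<in> E\<^sub>2 h" if "h \<in> carrier H" "n \<in> carrier N" for h n
    using le that P\<^sub>2.action_class_eq_iff[OF P\<^sub>1.action_funcset] by (simp add: pair_le_def)
  have "g\<^sub>1 \<in> carrier H \<rightarrow> carrier H \<rightarrow> carrier N"
    using P\<^sub>1.factor_set unfolding factor_sets_def by blast
  moreover have "(g\<^sub>1 h \<one>\<^bsub>H\<^esub>, \<one>\<^bsub>N\<^esub>) \<in> E\<^sub>2 h \<and> (\<one>\<^bsub>N\<^esub>, g\<^sub>1 \<one>\<^bsub>H\<^esub> h) \<in> E\<^sub>2 h" if "h \<in> carrier H" for h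
    using that P\<^sub>1.factor_set_one_right[OF P\<^sub>1.factor_set that]
      P\<^sub>1.factor_set_one_left[OF P\<^sub>1.factor_set that] sub P\<^sub>2.E_sym by blast
  moreover have "(g\<^sub>1 x y \<otimes>\<^bsub>N\<^esub> g\<^sub>1 (x \<otimes>\<^bsub>H\<^esub> y) z, \<phi>\<^sub>2 x (g\<^sub>1 y z) \<otimes>\<^bsub>N\<^esub> g\<^sub>1 x (y \<otimes>\<^bsub>H\<^esub> z))
      \<in> E\<^sub>2 (x \<otimes>\<^bsub>H\<^esub> y \<otimes>\<^bsub>H\<^esub> z)"
    if x: "x \<in> carrier H" "y \<in> carrier H" "z \<in> carrier H" for x y z
  proof -
    have xyz: "x \<otimes>\<^bsub>H\<^esub> y \<otimes>\<^bsub>H\<^esub> z \<in> carrier H" using x by simp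
    have "(g\<^sub>1 x y \<otimes>\<^bsub>N\<^esub> g\<^sub>1 (x \<otimes>\<^bsub>H\<^esub> y) z, \<phi>\<^sub>1 x (g\<^sub>1 y z) \<otimes>\<^bsub>N\<^esub> g\<^sub>1 x (y \<otimes>\<^bsub>H\<^esub> z))
        \<in> E\<^sub>2 (x \<otimes>\<^bsub>H\<^esub> y \<otimes>\<^bsub>H\<^esub> z)"
      using P\<^sub>1.factor_set_cocycle[OF P\<^sub>1.factor_set x] xyz by (rule sub)
    moreover have "(\<phi>\<^sub>1 x (g\<^sub>1 y z), \<phi>\<^sub>2 x (g\<^sub>1 y z)) \<in> E\<^sub>2 (x \<otimes>\<^bsub>H\<^esub> y \<otimes>\<^bsub>H\<^esub> z)"
      using x P\<^sub>2.E_extend[OF act, of x "g\<^sub>1 y z" "y \<otimes>\<^bsub>H\<^esub> z"] by (simp add: P\<^sub>1.H.m_assoc)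
    then have "(\<phi>\<^sub>1 x (g\<^sub>1 y z) \<otimes>\<^bsub>N\<^esub> g\<^sub>1 x (y \<otimes>\<^bsub>H\<^esub> z), \<phi>\<^sub>2 x (g\<^sub>1 y z) \<otimes>\<^bsub>N\<^esub> g\<^sub>1 x (y \<otimes>\<^bsub>H\<^esub> z))
        \<in> E\<^sub>2 (x \<otimes>\<^bsub>H\<^esub> y \<otimes>\<^bsub>H\<^esub> z)"
      using x xyz by (intro P\<^sub>2.E_mult P\<^sub>2.E_refl) auto
    ultimately show ?thesis
      using xyz by (blast intro: P\<^sub>2.E_trans)
  qed
  ultimately show ?thesis
    unfolding factor_sets_def by blast
qed

text \<open>The cochain \<open>t\<close> is read off from \<open>F ([1], h) = ([t h], h)\<close>.  The inclusion of the
  equivalences holds because \<open>F ([n], h) = ([n t(h)], h)\<close> depends only on the class of \<open>n\<close>.  The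
  products \<open>([1], h) ([n], 1)\<close> and \<open>([1], h) ([1], h')\<close>, each computed before and after applying
  \<open>F\<close>, give the agreement of the actions and the coboundary relation.\<close>

lemma crossed_product_morphism_imp:
  assumes F: "crossed_product_morphism F"
  shows "pair_le H N E\<^sub>1 \<phi>\<^sub>1 E\<^sub>2 \<phi>\<^sub>2" and "(g\<^sub>1, g\<^sub>2) \<in> cohomologous H N E\<^sub>2 \<phi>\<^sub>2"
proof -
  have F_closed: "F x \<in> carrier P\<^sub>2.CP" if "x \<in> carrier P\<^sub>1.CP" for x
    using F that by (auto simp: extension_morphism_def monoid_hom_def hom_def)
  have F_mult: "F (x \<otimes>\<^bsub>P\<^sub>1.CP\<^esub> y) = F x \<otimes>\<^bsub>P\<^sub>2.CP\<^esub> F y"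
    if "x \<in> carrier P\<^sub>1.CP" "y \<in> carrier P\<^sub>1.CP" for x y
    using F that by (simp add: extension_morphism_def monoid_hom_def hom_def)
  have F_kernel: "F (P\<^sub>1.elt n \<one>\<^bsub>H\<^esub>) = P\<^sub>2.elt n \<one>\<^bsub>H\<^esub>" if "n \<in> carrier N" for n
    using F that by (simp add: extension_morphism_def crossed_product_k_def)
  have F_snd: "snd (F x) = snd x" if "x \<in> carrier P\<^sub>1.CP" for x
    using F that by (simp add: extension_morphism_def crossed_product_e_def)

  have "\<exists>n\<in>carrier N. F (P\<^sub>1.elt \<one>\<^bsub>N\<^esub> h) = P\<^sub>2.elt n h" if h: "h \<in> carrier H" for h
  proof -
    have cl: "P\<^sub>1.elt \<one>\<^bsub>N\<^esub> h \<in> carrier P\<^sub>1.CP"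
      using h by (intro P\<^sub>1.elt_closed) auto
    obtain n h' where "n \<in> carrier N" "F (P\<^sub>1.elt \<one>\<^bsub>N\<^esub> h) = P\<^sub>2.elt n h'"
      using F_closed[OF cl] by (rule P\<^sub>2.crossed_product_cases)
    with F_snd[OF cl] show ?thesis by auto
  qed
  then obtain t where t: "t h \<in> carrier N" "F (P\<^sub>1.elt \<one>\<^bsub>N\<^esub> h) = P\<^sub>2.elt (t h) h"
    if "h \<in> carrier H" for h
    by metis
  have t_one: "t \<one>\<^bsub>H\<^esub> = \<one>\<^bsub>N\<^esub>"
    using t[OF P\<^sub>1.H.one_closed] F_kernel[OF P\<^sub>1.N.one_closed]
    by (intro P\<^sub>2.E_one) (simp flip: P\<^sub>2.class_eq_iff)
  have F_elt: "F (P\<^sub>1.elt n h) = P\<^sub>2.elt (n \<otimes>\<^bsub>N\<^esub> t h) h"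
    if n: "n \<in> carrier N" and h: "h \<in> carrier H" for n h
  proof -
    have "F (P\<^sub>1.elt n h) = F (P\<^sub>1.elt n \<one>\<^bsub>H\<^esub> \<otimes>\<^bsub>P\<^sub>1.CP\<^esub> P\<^sub>1.elt \<one>\<^bsub>N\<^esub> h)"
      using n h by (subst P\<^sub>1.kernel_mult_elt) auto
    also have "\<dots> = P\<^sub>2.elt n \<one>\<^bsub>H\<^esub> \<otimes>\<^bsub>P\<^sub>2.CP\<^esub> P\<^sub>2.elt (t h) h"
      using n h t(2)[OF h] F_kernel[OF n]
      by (subst F_mult) (auto intro: P\<^sub>1.elt_closed)
    also have "\<dots> = P\<^sub>2.elt (n \<otimes>\<^bsub>N\<^esub> t h) h"
      using n h t(1)[OF h] by (rule P\<^sub>2.kernel_mult_elt)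
    finally show ?thesis .
  qed

  have sub: "E\<^sub>1 h \<subseteq> E\<^sub>2 h" if h: "h \<in> carrier H" for h
  proof (rule subrelI)
    fix a b assume ab: "(a, b) \<in> E\<^sub>1 h"
    then have cl: "a \<in> carrier N" "b \<in> carrier N"
      using h P\<^sub>1.E_closed by auto
    then have "P\<^sub>1.elt a h = P\<^sub>1.elt b h"
      using ab h by (simp add: P\<^sub>1.class_eq_iff)
    then have "P\<^sub>2.elt (a \<otimes>\<^bsub>N\<^esub> t h) h = P\<^sub>2.elt (b \<otimes>\<^bsub>N\<^esub> t h) h"
      using F_elt cl h by metis
    then have "(t h \<otimes>\<^bsub>N\<^esub> a, t h \<otimes>\<^bsub>N\<^esub> b) \<in> E\<^sub>2 h"
      using cl h t(1)[OF h] by (simp add: P\<^sub>2.class_eq_iff P\<^sub>1.N.m_comm)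
    then show "(a, b) \<in> E\<^sub>2 h"
      by (rule P\<^sub>2.E_mult_cancel) (use cl h t(1)[OF h] in auto)
  qed

  have act: "(\<phi>\<^sub>1 h n, \<phi>\<^sub>2 h n) \<in> E\<^sub>2 h" if h: "h \<in> carrier H" and n: "n \<in> carrier N" for h n
  proof -
    note th = t(1)[OF h]
    have "P\<^sub>2.elt (\<phi>\<^sub>1 h n \<otimes>\<^bsub>N\<^esub> t h) h = F (P\<^sub>1.elt \<one>\<^bsub>N\<^esub> h \<otimes>\<^bsub>P\<^sub>1.CP\<^esub> P\<^sub>1.elt n \<one>\<^bsub>H\<^esub>)"
      using n h by (simp add: P\<^sub>1.elt_mult_kernel F_elt)
    also have "\<dots> = P\<^sub>2.elt (t h) h \<otimes>\<^bsub>P\<^sub>2.CP\<^esub> P\<^sub>2.elt n \<one>\<^bsub>H\<^esub>"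
      using n h t(2)[OF h] F_kernel[OF n]
      by (subst F_mult) (auto intro: P\<^sub>1.elt_closed)
    also have "\<dots> = P\<^sub>2.elt (t h \<otimes>\<^bsub>N\<^esub> \<phi>\<^sub>2 h n) h"
      using n h th by (simp add: P\<^sub>2.elt_mult_kernel)
    finally have "(t h \<otimes>\<^bsub>N\<^esub> \<phi>\<^sub>1 h n, t h \<otimes>\<^bsub>N\<^esub> \<phi>\<^sub>2 h n) \<in> E\<^sub>2 h"
      using n h th by (simp add: P\<^sub>2.class_eq_iff P\<^sub>1.N.m_comm)
    then show ?thesis
      by (rule P\<^sub>2.E_mult_cancel) (use n h th in auto)
  qed

  show le: "pair_le H N E\<^sub>1 \<phi>\<^sub>1 E\<^sub>2 \<phi>\<^sub>2"
    using sub act P\<^sub>2.action_class_eq_iff[OF P\<^sub>1.action_funcset] by (simp add: pair_le_def)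

  have "(coboundary H N \<phi>\<^sub>2 t h h' \<otimes>\<^bsub>N\<^esub> g\<^sub>2 h h', g\<^sub>1 h h') \<in> E\<^sub>2 (h \<otimes>\<^bsub>H\<^esub> h')"
    if h: "h \<in> carrier H" "h' \<in> carrier H" for h h'
  proof -
    let ?u = "t (h \<otimes>\<^bsub>H\<^esub> h')"
    have hh': "h \<otimes>\<^bsub>H\<^esub> h' \<in> carrier H" using h by simp
    note cl = t(1)[OF h(1)] t(1)[OF h(2)] t(1)[OF hh'] h hh'
    have "P\<^sub>2.elt (g\<^sub>1 h h' \<otimes>\<^bsub>N\<^esub> ?u) (h \<otimes>\<^bsub>H\<^esub> h') = F (P\<^sub>1.elt \<one>\<^bsub>N\<^esub> h \<otimes>\<^bsub>P\<^sub>1.CP\<^esub> P\<^sub>1.elt \<one>\<^bsub>N\<^esub> h')"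
      using h hh' by (simp add: P\<^sub>1.elt_mult_section F_elt)
    also have "\<dots> = P\<^sub>2.elt (t h) h \<otimes>\<^bsub>P\<^sub>2.CP\<^esub> P\<^sub>2.elt (t h') h'"
      using h t(2)[OF h(1)] t(2)[OF h(2)] by (subst F_mult) (auto intro: P\<^sub>1.elt_closed)
    also have "\<dots> = P\<^sub>2.elt (t h \<otimes>\<^bsub>N\<^esub> \<phi>\<^sub>2 h (t h') \<otimes>\<^bsub>N\<^esub> g\<^sub>2 h h') (h \<otimes>\<^bsub>H\<^esub> h')"
      using cl by (intro P\<^sub>2.elt_mult)
    finally have "(g\<^sub>1 h h' \<otimes>\<^bsub>N\<^esub> ?u, t h \<otimes>\<^bsub>N\<^esub> \<phi>\<^sub>2 h (t h') \<otimes>\<^bsub>N\<^esub> g\<^sub>2 h h') \<in> E\<^sub>2 (h \<otimes>\<^bsub>H\<^esub> h')"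
      using cl by (simp add: P\<^sub>2.class_eq_iff)
    then have "(t h \<otimes>\<^bsub>N\<^esub> \<phi>\<^sub>2 h (t h') \<otimes>\<^bsub>N\<^esub> g\<^sub>2 h h', g\<^sub>1 h h' \<otimes>\<^bsub>N\<^esub> ?u) \<in> E\<^sub>2 (h \<otimes>\<^bsub>H\<^esub> h')"
      using hh' by (rule P\<^sub>2.E_sym)
    then have "(inv\<^bsub>N\<^esub> ?u \<otimes>\<^bsub>N\<^esub> (t h \<otimes>\<^bsub>N\<^esub> \<phi>\<^sub>2 h (t h') \<otimes>\<^bsub>N\<^esub> g\<^sub>2 h h'), inv\<^bsub>N\<^esub> ?u \<otimes>\<^bsub>N\<^esub> (g\<^sub>1 h h' \<otimes>\<^bsub>N\<^esub> ?u))
        \<in> E\<^sub>2 (h \<otimes>\<^bsub>H\<^esub> h')"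
      using cl by (intro P\<^sub>2.E_mult_left) auto
    moreover have "inv\<^bsub>N\<^esub> ?u \<otimes>\<^bsub>N\<^esub> (g\<^sub>1 h h' \<otimes>\<^bsub>N\<^esub> ?u) = g\<^sub>1 h h'"
      using cl by (simp add: P\<^sub>1.N.m_comm[of "g\<^sub>1 h h'"] P\<^sub>1.N.m_assoc[symmetric])
    moreover have "inv\<^bsub>N\<^esub> ?u \<otimes>\<^bsub>N\<^esub> (t h \<otimes>\<^bsub>N\<^esub> \<phi>\<^sub>2 h (t h') \<otimes>\<^bsub>N\<^esub> g\<^sub>2 h h') =
        coboundary H N \<phi>\<^sub>2 t h h' \<otimes>\<^bsub>N\<^esub> g\<^sub>2 h h'"
      using cl by (simp add: coboundary_def P\<^sub>1.N.m_ac)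
    ultimately show ?thesis by simp
  qed
  then show "(g\<^sub>1, g\<^sub>2) \<in> cohomologous H N E\<^sub>2 \<phi>\<^sub>2"
    using t(1) t_one factor_set_mono[OF le] P\<^sub>2.factor_set
    unfolding P\<^sub>2.cohomologous_iff by (auto intro!: bexI[of _ t])
qed

text \<open>The morphism is \<open>([n], h) \<mapsto> ([n t(h)], h)\<close>, where \<open>t\<close> is a cochain whose coboundary
  relates \<open>g\<^sub>1\<close> and \<open>g\<^sub>2\<close>; the normalization \<open>t 1 = 1\<close> makes it fix \<open>N\<close>.\<close>

lemma crossed_product_morphismI:
  assumes le: "pair_le H N E\<^sub>1 \<phi>\<^sub>1 E\<^sub>2 \<phi>\<^sub>2" and "(g\<^sub>1, g\<^sub>2) \<in> cohomologous H N E\<^sub>2 \<phi>\<^sub>2"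
  obtains F where "crossed_product_morphism F"
proof -
  obtain t where t: "t \<in> carrier H \<rightarrow> carrier N" and t_one: "t \<one>\<^bsub>H\<^esub> = \<one>\<^bsub>N\<^esub>"
    and eq: "\<And>h h'. h \<in> carrier H \<Longrightarrow> h' \<in> carrier H \<Longrightarrow>
      (coboundary H N \<phi>\<^sub>2 t h h' \<otimes>\<^bsub>N\<^esub> g\<^sub>2 h h', g\<^sub>1 h h') \<in> E\<^sub>2 (h \<otimes>\<^bsub>H\<^esub> h')"
    using assms(2) unfolding P\<^sub>2.cohomologous_iff by blast
  have t_closed [simp]: "t h \<in> carrier N" if "h \<in> carrier H" for h
    using that t by auto
  have sub: "(a, b) \<in> E\<^sub>2 h" if "(a, b) \<in> E\<^sub>1 h" "h \<in> carrier H" for a b h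
    using le that by (auto simp: pair_le_def)
  have act: "(\<phi>\<^sub>1 h n, \<phi>\<^sub>2 h n) \<in> E\<^sub>2 h" if "h \<in> carrier H" "n \<in> carrier N" for h n
    using le that P\<^sub>2.action_class_eq_iff[OF P\<^sub>1.action_funcset] by (simp add: pair_le_def)
  define F where "F = (\<lambda>(A, h). (\<Union>n\<in>A. E\<^sub>2 h `` {n \<otimes>\<^bsub>N\<^esub> t h}, h))"
  have F_elt: "F (P\<^sub>1.elt n h) = P\<^sub>2.elt (n \<otimes>\<^bsub>N\<^esub> t h) h"
    if n: "n \<in> carrier N" and h: "h \<in> carrier H" for n h
  proof -
    have "E\<^sub>2 h `` {a \<otimes>\<^bsub>N\<^esub> t h} = E\<^sub>2 h `` {n \<otimes>\<^bsub>N\<^esub> t h}" if "a \<in> E\<^sub>1 h `` {n}" for a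
    proof -
      have a: "(a, n) \<in> E\<^sub>1 h" using that h P\<^sub>1.E_sym by auto
      then have "a \<in> carrier N" using h P\<^sub>1.E_closed by auto
      moreover have "(a \<otimes>\<^bsub>N\<^esub> t h, n \<otimes>\<^bsub>N\<^esub> t h) \<in> E\<^sub>2 h"
        using h a by (intro P\<^sub>2.E_mult P\<^sub>2.E_refl sub) auto
      ultimately show ?thesis
        using n h by (simp add: P\<^sub>2.class_eq_iff)
    qed
    moreover have "n \<in> E\<^sub>1 h `` {n}"
      using n h P\<^sub>1.E_refl by auto
    ultimately have "(\<Union>a\<in>E\<^sub>1 h `` {n}. E\<^sub>2 h `` {a \<otimes>\<^bsub>N\<^esub> t h}) = E\<^sub>2 h `` {n \<otimes>\<^bsub>N\<^esub> t h}"
      by blast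
    then show ?thesis by (simp add: F_def)
  qed
  have F_kernel: "F (crossed_product_k H E\<^sub>1 n) = crossed_product_k H E\<^sub>2 n" if "n \<in> carrier N" for n
    using F_elt[of n "\<one>\<^bsub>H\<^esub>"] that t_one by (simp add: crossed_product_k_def)
  have F_mult: "F (x \<otimes>\<^bsub>P\<^sub>1.CP\<^esub> y) = F x \<otimes>\<^bsub>P\<^sub>2.CP\<^esub> F y"
    if x: "x \<in> carrier P\<^sub>1.CP" and y: "y \<in> carrier P\<^sub>1.CP" for x y
  proof -
    obtain n h where n: "n \<in> carrier N" and h: "h \<in> carrier H" and x_eq: "x = P\<^sub>1.elt n h"
      using x by (rule P\<^sub>1.crossed_product_cases)
    obtain n' h' where n': "n' \<in> carrier N" and h': "h' \<in> carrier H" and y_eq: "y = P\<^sub>1.elt n' h'"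
      using y by (rule P\<^sub>1.crossed_product_cases)
    let ?k = "h \<otimes>\<^bsub>H\<^esub> h'"
    have k: "?k \<in> carrier H" using h h' by simp
    note cl = n h n' h' k
    have F_xy: "F (x \<otimes>\<^bsub>P\<^sub>1.CP\<^esub> y) = P\<^sub>2.elt (n \<otimes>\<^bsub>N\<^esub> \<phi>\<^sub>1 h n' \<otimes>\<^bsub>N\<^esub> g\<^sub>1 h h' \<otimes>\<^bsub>N\<^esub> t ?k) ?k"
      using cl by (simp add: x_eq y_eq P\<^sub>1.elt_mult F_elt)
    have Fx_Fy: "F x \<otimes>\<^bsub>P\<^sub>2.CP\<^esub> F y =
        P\<^sub>2.elt (n \<otimes>\<^bsub>N\<^esub> t h \<otimes>\<^bsub>N\<^esub> \<phi>\<^sub>2 h (n' \<otimes>\<^bsub>N\<^esub> t h') \<otimes>\<^bsub>N\<^esub> g\<^sub>2 h h') ?k"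
      using cl by (simp add: x_eq y_eq F_elt P\<^sub>2.elt_mult)
    \<comment> \<open>Both representatives are compared with \<open>n \<phi>\<^sub>2(h,n') \<delta>t(h,h') g\<^sub>2(h,h') t(h h')\<close>, in which
      the factor \<open>t(h h')\<close> cancels its inverse in \<open>\<delta>t\<close>.\<close>
    have "(n \<otimes>\<^bsub>N\<^esub> \<phi>\<^sub>1 h n' \<otimes>\<^bsub>N\<^esub> g\<^sub>1 h h' \<otimes>\<^bsub>N\<^esub> t ?k,
        n \<otimes>\<^bsub>N\<^esub> \<phi>\<^sub>2 h n' \<otimes>\<^bsub>N\<^esub> (coboundary H N \<phi>\<^sub>2 t h h' \<otimes>\<^bsub>N\<^esub> g\<^sub>2 h h') \<otimes>\<^bsub>N\<^esub> t ?k) \<in> E\<^sub>2 ?k"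
      using cl by (intro P\<^sub>2.E_mult P\<^sub>2.E_refl P\<^sub>2.E_extend[OF act] P\<^sub>2.E_sym[OF eq]) auto
    moreover have "n \<otimes>\<^bsub>N\<^esub> \<phi>\<^sub>2 h n' \<otimes>\<^bsub>N\<^esub> (coboundary H N \<phi>\<^sub>2 t h h' \<otimes>\<^bsub>N\<^esub> g\<^sub>2 h h') \<otimes>\<^bsub>N\<^esub> t ?k =
        n \<otimes>\<^bsub>N\<^esub> t h \<otimes>\<^bsub>N\<^esub> (\<phi>\<^sub>2 h n' \<otimes>\<^bsub>N\<^esub> \<phi>\<^sub>2 h (t h')) \<otimes>\<^bsub>N\<^esub> g\<^sub>2 h h' \<otimes>\<^bsub>N\<^esub> (inv\<^bsub>N\<^esub> (t ?k) \<otimes>\<^bsub>N\<^esub> t ?k)"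
      using cl t_closed[OF h] t_closed[OF h'] t_closed[OF k]
      by (simp add: coboundary_def P\<^sub>1.N.m_ac del: P\<^sub>1.N.l_inv P\<^sub>1.N.Units_l_inv)
    moreover have "(n \<otimes>\<^bsub>N\<^esub> t h \<otimes>\<^bsub>N\<^esub> (\<phi>\<^sub>2 h n' \<otimes>\<^bsub>N\<^esub> \<phi>\<^sub>2 h (t h')) \<otimes>\<^bsub>N\<^esub> g\<^sub>2 h h',
        n \<otimes>\<^bsub>N\<^esub> t h \<otimes>\<^bsub>N\<^esub> \<phi>\<^sub>2 h (n' \<otimes>\<^bsub>N\<^esub> t h') \<otimes>\<^bsub>N\<^esub> g\<^sub>2 h h') \<in> E\<^sub>2 ?k"
      using cl
      by (intro P\<^sub>2.E_mult P\<^sub>2.E_refl P\<^sub>2.E_sym[OF P\<^sub>2.E_extend[OF P\<^sub>2.action_mult]]) auto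
    ultimately have "(n \<otimes>\<^bsub>N\<^esub> \<phi>\<^sub>1 h n' \<otimes>\<^bsub>N\<^esub> g\<^sub>1 h h' \<otimes>\<^bsub>N\<^esub> t ?k,
        n \<otimes>\<^bsub>N\<^esub> t h \<otimes>\<^bsub>N\<^esub> \<phi>\<^sub>2 h (n' \<otimes>\<^bsub>N\<^esub> t h') \<otimes>\<^bsub>N\<^esub> g\<^sub>2 h h') \<in> E\<^sub>2 ?k"
      using cl by (auto intro: P\<^sub>2.E_trans)
    then show ?thesis
      unfolding F_xy Fx_Fy using cl by (simp add: P\<^sub>2.class_eq_iff)
  qed
  have "F x \<in> carrier P\<^sub>2.CP \<and> snd (F x) = snd x" if x: "x \<in> carrier P\<^sub>1.CP" for x
  proof -
    obtain n h where "n \<in> carrier N" "h \<in> carrier H" "x = P\<^sub>1.elt n h"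
      using x by (rule P\<^sub>1.crossed_product_cases)
    then show ?thesis
      using P\<^sub>2.elt_closed by (simp add: F_elt)
  qed
  moreover have "F \<one>\<^bsub>P\<^sub>1.CP\<^esub> = \<one>\<^bsub>P\<^sub>2.CP\<^esub>"
    using F_kernel[of "\<one>\<^bsub>N\<^esub>"] by (simp add: crossed_product_def crossed_product_k_def)
  ultimately have "crossed_product_morphism F"
    using F_kernel F_mult
    by (simp add: extension_morphism_def monoid_hom_def hom_def crossed_product_e_def)
  then show thesis by (rule that)
qed

end


section \<open>Existence of morphisms between cosetal extensions\<close>

theorem theorem2p7:
  fixes H :: "('h, 's) monoid_scheme" and N :: "('n, 'r) monoid_scheme"
    and G\<^sub>1 :: "('a, 'p) monoid_scheme" and G\<^sub>2 :: "('b, 'q) monoid_scheme"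
    and k\<^sub>1 :: "'n \<Rightarrow> 'a" and e\<^sub>1 :: "'a \<Rightarrow> 'h"
    and k\<^sub>2 :: "'n \<Rightarrow> 'b" and e\<^sub>2 :: "'b \<Rightarrow> 'h"
    and E\<^sub>1 E\<^sub>2 :: "'h \<Rightarrow> ('n \<times> 'n) set"
    and \<phi>\<^sub>1 \<phi>\<^sub>2 :: "'h \<Rightarrow> 'n \<Rightarrow> 'n"
    and g\<^sub>1 g\<^sub>2 :: "'h \<Rightarrow> 'h \<Rightarrow> 'n"
  assumes "monoid H" and "comm_group N"
    and "compatible_pair H N E\<^sub>1 \<phi>\<^sub>1" and "compatible_pair H N E\<^sub>2 \<phi>\<^sub>2"
    and "factor_class H N E\<^sub>1 \<phi>\<^sub>1 g\<^sub>1 \<in> carrier (cohomology2 H N E\<^sub>1 \<phi>\<^sub>1)"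
    and "factor_class H N E\<^sub>2 \<phi>\<^sub>2 g\<^sub>2 \<in> carrier (cohomology2 H N E\<^sub>2 \<phi>\<^sub>2)"
    and "cosetal_extension N k\<^sub>1 G\<^sub>1 e\<^sub>1 H" and "corresponds_to N k\<^sub>1 G\<^sub>1 e\<^sub>1 H E\<^sub>1 \<phi>\<^sub>1 g\<^sub>1"
    and "cosetal_extension N k\<^sub>2 G\<^sub>2 e\<^sub>2 H" and "corresponds_to N k\<^sub>2 G\<^sub>2 e\<^sub>2 H E\<^sub>2 \<phi>\<^sub>2 g\<^sub>2"
  shows "(\<exists>f. extension_morphism N k\<^sub>1 G\<^sub>1 e\<^sub>1 k\<^sub>2 G\<^sub>2 e\<^sub>2 f) \<longleftrightarrow>
    pair_le H N E\<^sub>1 \<phi>\<^sub>1 E\<^sub>2 \<phi>\<^sub>2 \<and>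
    factor_class H N E\<^sub>2 \<phi>\<^sub>2 g\<^sub>1 = factor_class H N E\<^sub>2 \<phi>\<^sub>2 g\<^sub>2"
proof -
  interpret P\<^sub>1: compatible_pair_on H N E\<^sub>1 \<phi>\<^sub>1
    using assms(1-3) by (simp add: compatible_pair_on_def compatible_pair_on_axioms_def)
  interpret P\<^sub>2: compatible_pair_on H N E\<^sub>2 \<phi>\<^sub>2
    using assms(1,2,4) by (simp add: compatible_pair_on_def compatible_pair_on_axioms_def)
  interpret two_crossed_products H N E\<^sub>1 E\<^sub>2 \<phi>\<^sub>1 \<phi>\<^sub>2 g\<^sub>1 g\<^sub>2
    using P\<^sub>1.factor_set_of_class[OF assms(5)] P\<^sub>2.factor_set_of_class[OF assms(6)]
    by unfold_locales
  have "(\<exists>f. extension_morphism N k\<^sub>1 G\<^sub>1 e\<^sub>1 k\<^sub>2 G\<^sub>2 e\<^sub>2 f) \<longleftrightarrow> (\<exists>F. crossed_product_morphism F)"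
    using assms(7-10) unfolding cosetal_extension_def corresponds_to_def
    by (intro extension_morphism_iff_of_isomorphic) auto
  also have "\<dots> \<longleftrightarrow> pair_le H N E\<^sub>1 \<phi>\<^sub>1 E\<^sub>2 \<phi>\<^sub>2 \<and> (g\<^sub>1, g\<^sub>2) \<in> cohomologous H N E\<^sub>2 \<phi>\<^sub>2"
    using crossed_product_morphism_imp crossed_product_morphismI by metis
  finally show ?thesis
    using P\<^sub>2.factor_class_eq_iff[OF P\<^sub>2.factor_set_of_class[OF assms(6)]] by simp
qed

end
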